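(* For all $r\ge 1$, $\mathcal{D}(F_r)=AE_{2r}$, where $F_r$ is the Ferrers graph of the staircase shape of height $r$ with its vertices labeled and ordered as $1<2<\cdots<2r$, and $AE_{2r}$ is the set of permutations of $\{1,\dots,2r\}$ with alternating excedances.
   Context: **Ferrers graphs of staircase shapes.** The staircase shape of height $r$ is the Ferrers shape $\sigma_r=(r,r-1,\dots,2,1)$. Its Ferrers graph $F_r$ is the bipartite graph on $2r$ vertices, $r$ of which correspond to the rows and $r$ to the columns of $\sigma_r$, where a row vertex and a column vertex are adjacent if there is a square of $\sigma_r$ in that row and column. The rows are labeled $1,3,5,\dots,2r-1$ so that labels increase as row lengths decrease; the columns are labeled $2,4,\dots,2r$ so that labels decrease as column lengths decrease. Thus $F_r$ has vertex set $\{1,\dots,2r\}$, with the usual order, and its edges are exactly the pairs $\{2i+1,2j\}$ with $0\le i<j\le r$ (each odd vertex is adjacent exactly to all larger even vertices). **Alternating excedances.** A permutation $w$ of $\{1,\dots,2r\}$ has alternating excedances if $w(i)>i$ whenever $i$ is odd and $w(i)<i$ whenever $i$ is even. $AE_{2r}$ is the set of such permutations. **Ordered graphs and edge operations.** An ordered graph is a finite simple graph $G$ together with a linear order on its vertex set $V(G)$; $|G|$ is the number of vertices. If the maximal vertex $t$ of $G$ is not isolated, the maximal edge of $G$ is $e=\{s,t\}$, where $s$ is the maximal vertex adjacent to $t$. For $e=\{s,t\}$ with $s<t$: - Deletion: $G-e$ is $G$ with the edge $e$ removed (same vertices, same order). A permutation of $V(G-e)$ is a permutation of $V(G)$. - Simple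 contraction: $G/e$ is obtained by contracting $e$ to a single vertex $x$ and removing loops and redundant (multiple) edges; $x$ takes the place of $s$ in the order. For a permutation $w$ of $V(G/e)$, $w_{st}$ denotes the permutation of $V(G)$ obtained by writing $w$ in cycle notation and replacing $x$ by the two consecutive letters $s\,t$ in its cycle. - Extraction: $G-[e]$ is obtained by removing $e$ and its two incident vertices $s,t$ (restricted order). For a permutation $w$ of $V(G-[e])$, $w\sqcup(st)$ is the permutation of $V(G)$ equal to $w$ on $V(G)\setminus\{s,t\}$ and exchanging $s$ and $t$. **The set $\mathcal{D}(G)$.** For a nonempty ordered graph $G$ with maximal vertex $t$, the set $\mathcal{D}(G)$ of permutations of $V(G)$ is defined recursively: - If $V(G)=\{s,t\}$ and $s,t$ are adjacent, then $\mathcal{D}(G)=\{(st)\}$. - If $t$ is isolated, then $\mathcal{D}(G)=\emptyset$. - If $t$ is not isolated, $|G|\ge 3$, and $e=\{s,t\}$ is the maximal edge, then $$\mathcal{D}(G)=\mathcal{D}(G-e)\cup\{w_{st}: w\in\mathcal{D}(G/e)\}\cup\{w\sqcup(st): w\in\mathcal{D}(G-[e])\}.$$ *)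

theory Defs
  imports "HOL-Combinatorics.Permutations"
begin

text \<open>
  An ordered graph is given by its vertex set and its set of edges (two-element vertex sets);
  the order on the vertices is that of the type. As usual with \<^const>\<open>permutes\<close>, a permutation
  of \<open>V\<close> is a function on the whole type that is the identity outside \<open>V\<close>.
\<close>

definition ordered_graph :: "'a::linorder set \<Rightarrow> 'a set set \<Rightarrow> bool" where
  "ordered_graph V E \<longleftrightarrow> finite V \<and> (\<forall>d\<in>E. d \<subseteq> V \<and> card d = 2)"

definition neighbours :: "'a set set \<Rightarrow> 'a \<Rightarrow> 'a set" where
  "neighbours E v = {u. {u, v} \<in> E}"

definition delete_edges :: "'a set set \<Rightarrow> 'a \<Rightarrow> 'a \<Rightarrow> 'a set set" where
  "delete_edges E s t = E - {{s, t}}"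

text \<open>
  The vertex arising from contracting \<open>{s, t}\<close> takes the place of \<open>s\<close> in the order, so it is
  represented by \<open>s\<close> itself. An edge both of whose ends are mapped to \<open>s\<close> becomes a singleton,
  i.e. a loop; parallel edges are merged because edges form a set.
\<close>

definition contract_vertices :: "'a set \<Rightarrow> 'a \<Rightarrow> 'a \<Rightarrow> 'a set" where
  "contract_vertices V s t = id(t := s) ` V"

definition contract_edges :: "'a set set \<Rightarrow> 'a \<Rightarrow> 'a \<Rightarrow> 'a set set" where
  "contract_edges E s t = {d \<in> (`) (id(t := s)) ` E. card d = 2}"

definition extract_vertices :: "'a set \<Rightarrow> 'a \<Rightarrow> 'a \<Rightarrow> 'a set" where
  "extract_vertices V s t = V - {s, t}"

definition extract_edges :: "'a set set \<Rightarrow> 'a \<Rightarrow> 'a \<Rightarrow> 'a set set" where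
  "extract_edges E s t = {d \<in> E. s \<notin> d \<and> t \<notin> d}"

text \<open>
  In cycle notation, \<open>(\<dots> a s b \<dots>)\<close> becomes \<open>(\<dots> a s t b \<dots>)\<close>, where a cycle \<open>(\<dots> a b \<dots>)\<close> maps
  \<open>a\<close> to \<open>b\<close>. A fixed point \<open>s\<close> becomes the cycle \<open>(s t)\<close>.
\<close>

definition insert_after :: "('a \<Rightarrow> 'a) \<Rightarrow> 'a \<Rightarrow> 'a \<Rightarrow> 'a \<Rightarrow> 'a" where
  "insert_after w s t = w(s := t, t := w s)"

definition add_transposition :: "('a \<Rightarrow> 'a) \<Rightarrow> 'a \<Rightarrow> 'a \<Rightarrow> 'a \<Rightarrow> 'a" where
  "add_transposition w s t = w(s := t, t := s)"

lemma neighbours_Max: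
  assumes "ordered_graph V E" "neighbours E t \<noteq> {}"
  shows "{Max (neighbours E t), t} \<in> E" "Max (neighbours E t) \<in> V" "t \<in> V"
    "Max (neighbours E t) \<noteq> t"
proof -
  have "neighbours E t \<subseteq> V"
    using assms(1) by (auto simp: neighbours_def ordered_graph_def)
  then have "finite (neighbours E t)"
    using assms(1) by (auto simp: ordered_graph_def intro: finite_subset)
  then have "Max (neighbours E t) \<in> neighbours E t"
    using assms(2) by (rule Max_in)
  then show *: "{Max (neighbours E t), t} \<in> E"
    by (simp add: neighbours_def)
  then show "Max (neighbours E t) \<in> V" "t \<in> V"
    using assms(1) by (auto simp: ordered_graph_def)
  have "card {Max (neighbours E t), t} = 2"
    using * assms(1) by (auto simp: ordered_graph_def)
  then show "Max (neighbours E t) \<noteq> t"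
    by auto
qed

lemma ordered_graph_finite_edges: "ordered_graph V E \<Longrightarrow> finite E"
  by (rule finite_subset[of _ "Pow V"]) (auto simp: ordered_graph_def)

text \<open>
  On arguments that do not form a nonempty ordered graph, the value is the dummy \<open>{}\<close>.
\<close>

function D_perms :: "'a::linorder set \<Rightarrow> 'a set set \<Rightarrow> ('a \<Rightarrow> 'a) set" where
  "D_perms V E =
    (if \<not> ordered_graph V E \<or> V = {} then {}
     else let t = Max V in
       if neighbours E t = {} then {}
       else let s = Max (neighbours E t) in
         if V = {s, t} then {Transposition.transpose s t}
         else D_perms V (delete_edges E s t)
           \<union> {insert_after w s t |w. w \<in> D_perms (contract_vertices V s t) (contract_edges E s t)}
           \<union> {add_transposition w s t |w.
                w \<in> D_perms (extract_vertices V s t) (extract_edges E s t)})"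
  by pat_completeness auto

termination
proof (relation "measures [\<lambda>(V, E). card V, \<lambda>(V, E). card E]", goal_cases)
  case 1
  show ?case by simp
next
  case (2 V E t s)
  have "card (E - {{s, t}}) < card E"
    using 2 neighbours_Max(1)[of V E t] ordered_graph_finite_edges[of V E]
    by (intro card_Diff1_less) auto
  then show ?case
    by (simp add: delete_edges_def)
next
  case (3 V E t s)
  have "contract_vertices V s t = V - {t}"
    using 3 neighbours_Max[of V E t] by (auto simp: contract_vertices_def)
  moreover have "card (V - {t}) < card V"
    using 3 neighbours_Max(3)[of V E t]
    by (intro card_Diff1_less) (auto simp: ordered_graph_def)
  ultimately show ?case
    by simp
next
  case (4 V E t s)
  have "V - {s, t} \<subset> V"
    using 4 neighbours_Max(3)[of V E t] by auto
  moreover have "finite V"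
    using 4 by (simp add: ordered_graph_def)
  ultimately have "card (V - {s, t}) < card V"
    by (intro psubset_card_mono)
  then show ?case
    by (simp add: extract_vertices_def)
qed

declare D_perms.simps [simp del]

lemma ordered_graph_delete:
  "ordered_graph V E \<Longrightarrow> ordered_graph V (delete_edges E s t)"
  by (auto simp: ordered_graph_def delete_edges_def)

lemma ordered_graph_contract:
  "ordered_graph V E \<Longrightarrow> ordered_graph (contract_vertices V s t) (contract_edges E s t)"
  unfolding ordered_graph_def contract_vertices_def contract_edges_def by blast

lemma ordered_graph_extract:
  "ordered_graph V E \<Longrightarrow> ordered_graph (extract_vertices V s t) (extract_edges E s t)"
  by (auto simp: ordered_graph_def extract_vertices_def extract_edges_def)

text \<open>
  A Ferrers shape is the list of its row lengths; rows and columns are numbered from 0.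
\<close>

definition squares :: "nat list \<Rightarrow> (nat \<times> nat) set" where
  "squares l = {(i, j). i < length l \<and> j < l ! i}"

definition staircase :: "nat \<Rightarrow> nat list" where
  "staircase r = rev [1..<r + 1]"

text \<open>
  Row \<open>i\<close> is labelled \<open>2 * i + 1\<close>, so labels increase as rows get shorter; column \<open>j\<close> is
  labelled \<open>2 * (r - j)\<close>, so labels decrease as columns get shorter.
\<close>

definition staircase_vertices :: "nat \<Rightarrow> nat set" where
  "staircase_vertices r = {1..2 * r}"

definition staircase_edges :: "nat \<Rightarrow> nat set set" where
  "staircase_edges r = {{2 * i + 1, 2 * (r - j)} |i j. (i, j) \<in> squares (staircase r)}"

lemma staircase_edges_eq:
  "staircase_edges r = {{2 * i + 1, 2 * j} |i j. i < j \<and> j \<le> r}"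
proof -
  have sq: "(i, j) \<in> squares (staircase r) \<longleftrightarrow> i < r \<and> j < r - i" for i j
    by (auto simp: squares_def staircase_def rev_nth simp del: upt_Suc)
  show ?thesis
  proof (intro equalityI subsetI)
    fix d assume "d \<in> staircase_edges r"
    then obtain i j where "d = {2 * i + 1, 2 * (r - j)}" "i < r" "j < r - i"
      by (auto simp: staircase_edges_def sq)
    moreover have "i < r - j" "r - j \<le> r"
      using \<open>j < r - i\<close> by auto
    ultimately show "d \<in> {{2 * i + 1, 2 * j} |i j. i < j \<and> j \<le> r}"
      by blast
  next
    fix d assume "d \<in> {{2 * i + 1, 2 * j} |i j. i < j \<and> j \<le> r}"
    then obtain i j where ij: "d = {2 * i + 1, 2 * j}" "i < j" "j \<le> r"
      by blast
    then have "d = {2 * i + 1, 2 * (r - (r - j))}" "(i, r - j) \<in> squares (staircase r)"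
      by (auto simp: sq)
    then show "d \<in> staircase_edges r"
      unfolding staircase_edges_def by blast
  qed
qed

lemma ordered_graph_staircase: "ordered_graph (staircase_vertices r) (staircase_edges r)"
proof -
  have "2 * i + 1 \<noteq> 2 * j" for i j :: nat
    by presburger
  then show ?thesis
    by (auto simp: ordered_graph_def staircase_vertices_def staircase_edges_eq card_insert_if)
qed

definition AE :: "nat \<Rightarrow> (nat \<Rightarrow> nat) set" where
  "AE n = {w. w permutes {1..n} \<and>
     (\<forall>i\<in>{1..n}. (odd i \<longrightarrow> w i > i) \<and> (even i \<longrightarrow> w i < i))}"

end

(*
  The graphs met in the recursion are given by two vertex sets R and C, with u < v adjacent iff u
  is in R and v is in C; the edges at the maximal vertex t may in addition be cut off at a bound m.
  Contracting the maximal edge {s, t} just adds s to C, extraction restricts R and C, and deletion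
  lowers the bound to s. On the side of permutations, consider those without fixed points whose
  excedances lie in R and whose anti-excedances lie in C, and that map only elements below m to t.
  Such a w satisfies either w^-1(t) < s (deletion) or w(s) = t. In the latter case w o (s t) fixes t;
  it fixes s as well (extraction) or it does not (contraction).
*)

theory Submission
  imports Defs
begin

section \<open>Edges and permutations prescribed by two vertex sets\<close>

definition exc_edges :: "'a::linorder set \<Rightarrow> 'a set \<Rightarrow> 'a \<Rightarrow> 'a \<Rightarrow> 'a set set" where
  "exc_edges R C t m = {{u, v} |u v. u \<in> R \<and> v \<in> C \<and> u < v \<and> (v = t \<longrightarrow> u < m)}"

text \<open>\<open>R\<close> and \<open>C\<close> may overlap: the vertex created by a contraction
  lies in both, so it may move up or down but may not be fixed.\<close>

definition exc_perms :: "'a::linorder set \<Rightarrow> 'a set \<Rightarrow> 'a set \<Rightarrow> ('a \<Rightarrow> 'a) set" where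
  "exc_perms V R C = {w. w permutes V \<and>
     (\<forall>v\<in>V. v < w v \<and> v \<in> R \<or> w v < v \<and> v \<in> C)}"

lemma exc_edges_unbounded:
  "exc_edges R C t t = {{u, v} |u v. u \<in> R \<and> v \<in> C \<and> u < v}"
  by (auto simp: exc_edges_def)

text \<open>The bound \<open>t\<close> on \<open>R\<close> and \<open>C\<close> forces
  \<open>t\<close> to be the upper end of any edge containing it.\<close>

lemma neighbours_exc_edges:
  assumes "\<And>v. v \<in> R \<union> C \<Longrightarrow> v \<le> t"
  shows "neighbours (exc_edges R C t m) t = {u \<in> R. t \<in> C \<and> u < t \<and> u < m}"
proof -
  have "u \<in> R \<and> t \<in> C \<and> u < t \<and> u < m"
    if eq: "{u, t} = {a, b}" and ab: "a \<in> R" "b \<in> C" "a < b" "b = t \<longrightarrow> a < m" for u a b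
  proof -
    have "b \<le> t"
      using assms ab by blast
    with eq ab have "u = a" "t = b"
      by (auto simp: doubleton_eq_iff)
    with ab show ?thesis
      by simp
  qed
  then show ?thesis
    unfolding neighbours_def exc_edges_def by blast
qed

lemma ordered_graph_exc_edges:
  assumes "finite V" "R \<subseteq> V" "C \<subseteq> V"
  shows "ordered_graph V (exc_edges R C t m)"
  using assms by (auto simp: ordered_graph_def exc_edges_def card_insert_if)

section \<open>Deletion, contraction and extraction of the maximal edge; \<open>s\<close> is the
  largest neighbour of \<open>t\<close>\<close>

context
  fixes R C :: "'a::linorder set" and s t m :: 'a
  assumes le: "\<And>v. v \<in> R \<union> C \<Longrightarrow> v \<le> t"
    and s: "s \<in> R" "s < t" "s < m" and t: "t \<in> C"
    and max: "\<And>u. u \<in> R \<Longrightarrow> u < t \<Longrightarrow> u < m \<Longrightarrow> u \<le> s"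
begin

text \<open>By maximality of \<open>s\<close>, a neighbour of \<open>t\<close> other than
  \<open>s\<close> lies below \<open>s\<close>. So removing one edge amounts to lowering the bound,
  and the edges with another upper end are untouched.\<close>

lemma delete_exc_edges: "delete_edges (exc_edges R C t m) s t = exc_edges R C t s"
proof (intro equalityI subsetI)
  fix d assume "d \<in> delete_edges (exc_edges R C t m) s t"
  then obtain u v where uv: "d = {u, v}" "u \<in> R" "v \<in> C" "u < v" "v = t \<longrightarrow> u < m" "d \<noteq> {s, t}"
    by (auto simp: delete_edges_def exc_edges_def)
  then have "v = t \<longrightarrow> u < s"
    using max by force
  with uv show "d \<in> exc_edges R C t s"
    by (auto simp: exc_edges_def)
next
  fix d assume "d \<in> exc_edges R C t s"
  then obtain u v where uv: "d = {u, v}" "u \<in> R" "v \<in> C" "u < v" "v = t \<longrightarrow> u < s"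
    by (auto simp: exc_edges_def)
  moreover have "v \<le> t"
    using le uv by blast
  ultimately have "d \<noteq> {s, t}"
    by (auto simp: doubleton_eq_iff)
  moreover have "v = t \<longrightarrow> u < m"
    using uv(5) s(3) by auto
  ultimately show "d \<in> delete_edges (exc_edges R C t m) s t"
    using uv by (auto simp: delete_edges_def exc_edges_def)
qed

text \<open>An edge \<open>{u, t}\<close> with \<open>u \<noteq> s\<close> becomes
  \<open>{u, s}\<close>, where \<open>u < s\<close> by maximality. Conversely, every
  \<open>u\<close> in \<open>R\<close> below \<open>s\<close> is below \<open>m\<close>, hence
  adjacent to \<open>t\<close>. So \<open>s\<close> becomes an admissible upper end and remains a
  lower one. Taking \<open>t'\<close> both as top vertex and as bound cuts off nothing, so
  \<open>t'\<close> stays free to be the new maximum.\<close>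

lemma contract_exc_edges:
  "contract_edges (exc_edges R C t m) s t = exc_edges (R - {t}) (insert s C - {t}) t' t'"
proof (intro equalityI subsetI)
  fix d assume "d \<in> contract_edges (exc_edges R C t m) s t"
  then obtain u v where uv: "d = id(t := s) ` {u, v}" "u \<in> R" "v \<in> C" "u < v"
      "v = t \<longrightarrow> u < m" and d: "card d = 2"
    unfolding contract_edges_def exc_edges_def by blast
  have ut: "u < t"
    using le[of v] uv by auto
  show "d \<in> exc_edges (R - {t}) (insert s C - {t}) t' t'"
  proof (cases "v = t")
    case True
    then have "d = {u, s}"
      using uv ut by auto
    \<comment> \<open>For \<open>u = s\<close> the image is the loop \<open>{s}\<close>, which
      \<open>card d = 2\<close> excludes.\<close>
    moreover have "u < s"
      using max[of u] uv True d \<open>d = {u, s}\<close> by (cases "u = s") auto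
    ultimately show ?thesis
      using uv s ut by (auto simp: exc_edges_def)
  next
    case False
    then have "d = {u, v}"
      using uv ut by auto
    then show ?thesis
      using uv ut False by (auto simp: exc_edges_def)
  qed
next
  fix d assume "d \<in> exc_edges (R - {t}) (insert s C - {t}) t' t'"
  then obtain u v where uv: "d = {u, v}" "u \<in> R" "u \<noteq> t" "v = s \<or> v \<in> C" "v \<noteq> t" "u < v"
    by (auto simp: exc_edges_def)
  have "d \<in> (`) (id(t := s)) ` exc_edges R C t m"
  proof (cases "v = s")
    case True
    then have "{u, t} \<in> exc_edges R C t m"
      using uv s t by (fastforce simp: exc_edges_def)
    moreover have "d = id(t := s) ` {u, t}"
      using uv True by auto
    ultimately show ?thesis
      by blast
  next
    case False
    then have "{u, v} \<in> exc_edges R C t m"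
      using uv by (auto simp: exc_edges_def)
    moreover have "d = id(t := s) ` {u, v}"
      using uv by auto
    ultimately show ?thesis
      by blast
  qed
  then show "d \<in> contract_edges (exc_edges R C t m) s t"
    using uv by (auto simp: contract_edges_def card_insert_if)
qed

end

lemma extract_exc_edges:
  "extract_edges (exc_edges R C t m) s t = exc_edges (R - {s, t}) (C - {s, t}) t' t'"
  by (auto simp: extract_edges_def exc_edges_def)

section \<open>Permutations sending \<open>s\<close> to the maximum, via composition with a
  transposition\<close>

lemma insert_after_eq_comp:
  "w t = t \<Longrightarrow> insert_after w s t = w \<circ> Transposition.transpose s t"
  by (auto simp: insert_after_def transpose_def fun_eq_iff)

lemma add_transposition_eq_comp:
  "w s = s \<Longrightarrow> w t = t \<Longrightarrow> add_transposition w s t = w \<circ> Transposition.transpose s t"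
  by (auto simp: add_transposition_def transpose_def fun_eq_iff)

lemma exc_perms_not_fixed: "w \<in> exc_perms V R C \<Longrightarrow> v \<in> V \<Longrightarrow> w v \<noteq> v"
  by (auto simp: exc_perms_def)

text \<open>Composing with the transposition of \<open>s\<close> and \<open>t\<close> is an
  involution, and it changes values only at \<open>s\<close> and \<open>t\<close>: if
  \<open>w s = t\<close>, the result fixes \<open>t\<close> and sends \<open>s\<close> to
  \<open>w t\<close>. The two sets correspond to \<open>w t \<noteq> s\<close> and
  \<open>w t = s\<close>.\<close>

lemma exc_perms_maps_to_max:
  assumes "\<And>v. v \<in> V \<Longrightarrow> v \<le> t" and "s \<in> R" "s < t" "t \<in> C" "s \<in> V" "t \<in> V"
  shows "{w \<in> exc_perms V R C. w s = t} =
     {insert_after w s t |w. w \<in> exc_perms (V - {t}) (R - {t}) (insert s C - {t})} \<union>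
     {add_transposition w s t |w. w \<in> exc_perms (V - {s, t}) (R - {s, t}) (C - {s, t})}"
    (is "?A = ?B \<union> ?D")
proof (intro equalityI subsetI)
  fix w assume w: "w \<in> ?A"
  define w' where "w' = w \<circ> Transposition.transpose s t"
  have st: "w' t = t" "w' s = w t" and other: "\<And>v. v \<noteq> s \<Longrightarrow> v \<noteq> t \<Longrightarrow> w' v = w v"
    using w by (auto simp: w'_def transpose_def)
  have w_eq: "w = w' \<circ> Transposition.transpose s t"
    by (simp add: w'_def comp_assoc)
  have w_perm: "w permutes V"
    using w by (simp add: exc_perms_def)
  then have w'_perm: "w' permutes V"
    unfolding w'_def using assms by (intro permutes_compose permutes_swap_id)
  have "w t < t" "w t \<in> V"
    using w assms(1)[of "w t"] assms(6) permutes_in_image[OF w_perm, of t]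
    by (force simp: exc_perms_def)+
  show "w \<in> ?B \<union> ?D"
  proof (cases "w t = s")
    case False
    have "w' permutes V - {t}"
      using w'_perm st by (auto intro: permutes_superset)
    \<comment> \<open>The only changed value is at \<open>s\<close>. There \<open>w' s = w t\<close>
      differs from \<open>s\<close>, and either direction is allowed because \<open>s\<close> lies
      in \<open>R\<close> and in the enlarged \<open>C\<close>.\<close>
    moreover have "v < w' v \<and> v \<in> R - {t} \<or> w' v < v \<and> v \<in> insert s C - {t}"
      if "v \<in> V - {t}" for v
      using that w False assms(2,3) st other[of v] by (cases "v = s") (auto simp: exc_perms_def)
    ultimately have "w' \<in> exc_perms (V - {t}) (R - {t}) (insert s C - {t})"
      by (simp add: exc_perms_def)
    moreover have "w = insert_after w' s t"
      using w_eq st by (simp add: insert_after_eq_comp)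
    ultimately show ?thesis
      by blast
  next
    case True
    have "w' permutes V - {s, t}"
      using w'_perm st True by (auto intro: permutes_superset)
    moreover have "v < w' v \<and> v \<in> R - {s, t} \<or> w' v < v \<and> v \<in> C - {s, t}"
      if "v \<in> V - {s, t}" for v
      using that w other[of v] by (auto simp: exc_perms_def)
    ultimately have "w' \<in> exc_perms (V - {s, t}) (R - {s, t}) (C - {s, t})"
      by (simp add: exc_perms_def)
    moreover have "w = add_transposition w' s t"
      using w_eq st True by (simp add: add_transposition_eq_comp)
    ultimately show ?thesis
      by blast
  qed
next
  fix w assume "w \<in> ?B \<union> ?D"
  then show "w \<in> ?A"
  proof
    assume "w \<in> ?B"
    then obtain w' where w': "w' \<in> exc_perms (V - {t}) (R - {t}) (insert s C - {t})"
      and w: "w = insert_after w' s t"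
      by blast
    have perm: "w' permutes V - {t}"
      using w' by (simp add: exc_perms_def)
    then have fix_t: "w' t = t"
      by (auto simp: permutes_def)
    have "w permutes V"
      unfolding w insert_after_eq_comp[of w', OF fix_t] using assms perm
      by (intro permutes_compose permutes_swap_id) (auto intro: permutes_subset)
    \<comment> \<open>This is the value of \<open>w\<close> at \<open>t\<close>, so \<open>t\<close>
      is an anti-excedance, as \<open>t \<in> C\<close> allows.\<close>
    moreover have "w' s < t"
      using permutes_in_image[OF perm, of s] assms(1)[of "w' s"] assms(3,5) by auto
    moreover have "v < w' v \<and> v \<in> R \<or> w' v < v \<and> v \<in> C" if "v \<in> V" "v \<noteq> s" "v \<noteq> t" for v
      using w' that by (auto simp: exc_perms_def)
    ultimately show ?thesis
      using assms by (auto simp: w exc_perms_def insert_after_def)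
  next
    assume "w \<in> ?D"
    then obtain w' where w': "w' \<in> exc_perms (V - {s, t}) (R - {s, t}) (C - {s, t})"
      and w: "w = add_transposition w' s t"
      by blast
    have perm: "w' permutes V - {s, t}"
      using w' by (simp add: exc_perms_def)
    then have fix_st: "w' s = s" "w' t = t"
      by (auto simp: permutes_def)
    have "w permutes V"
      unfolding w add_transposition_eq_comp[of w', OF fix_st] using assms perm
      by (intro permutes_compose permutes_swap_id) (auto intro: permutes_subset)
    moreover have "v < w' v \<and> v \<in> R \<or> w' v < v \<and> v \<in> C" if "v \<in> V" "v \<noteq> s" "v \<noteq> t" for v
      using w' that by (auto simp: exc_perms_def)
    ultimately show ?thesis
      using assms by (auto simp: w exc_perms_def add_transposition_def)
  qed
qed

lemma exc_perms_doubleton: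
  assumes "s < t" "s \<in> R" "t \<in> C"
  shows "exc_perms {s, t} R C = {Transposition.transpose s t}"
proof -
  have "w = Transposition.transpose s t" if "w \<in> exc_perms {s, t} R C" for w
  proof -
    have "w permutes {s, t}"
      using that by (simp add: exc_perms_def)
    moreover have "w \<noteq> id"
      using exc_perms_not_fixed[OF that, of s] by auto
    ultimately show ?thesis
      by (simp add: permutes_doubleton_iff)
  qed
  moreover have "Transposition.transpose s t \<in> exc_perms {s, t} R C"
    using assms by (auto simp: exc_perms_def intro: permutes_swap_id)
  ultimately show ?thesis
    by blast
qed

section \<open>The recursion for all graphs of this form\<close>

theorem D_perms_exc_edges:
  assumes "finite V" "V \<noteq> {}" "R \<subseteq> V" "C \<subseteq> V" "E = exc_edges R C (Max V) m"
  shows "D_perms V E = {w \<in> exc_perms V R C. \<forall>v\<in>V. w v = Max V \<longrightarrow> v < m}"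
  using assms
\<comment> \<open>Deletion changes \<open>m\<close>, while contraction and extraction change
  \<open>R\<close> and \<open>C\<close>, so all three are generalized.\<close>
proof (induction V E arbitrary: R C m rule: D_perms.induct)
  case (1 V E)
  define t where "t = Max V"
  define N where "N = neighbours E t"
  define s where "s = Max N"
  note prems = "1.prems" and fin = "1.prems"(1)
  have graph: "\<not> (\<not> ordered_graph V E \<or> V = {})"
    using prems by (auto simp: ordered_graph_exc_edges)
  have t: "t \<in> V" "\<And>v. v \<in> V \<Longrightarrow> v \<le> t"
    using prems by (auto simp: t_def)
  have le: "\<And>v. v \<in> R \<union> C \<Longrightarrow> v \<le> t"
    using prems t by blast
  have E: "E = exc_edges R C t m"
    using prems by (simp add: t_def)
  have N: "N = {u \<in> R. t \<in> C \<and> u < t \<and> u < m}"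
    using neighbours_exc_edges[OF le] by (simp add: N_def E)
  \<comment> \<open>No vertex is fixed and \<open>t\<close> is maximal: \<open>t\<close> must move
    down, and its preimage must move up.\<close>
  have preimage: "\<exists>v\<in>V. w v = t \<and> v < t \<and> v \<in> R \<and> t \<in> C" if "w \<in> exc_perms V R C" for w
  proof -
    have w: "w permutes V"
      using that by (simp add: exc_perms_def)
    then obtain v where v: "w v = t" "v \<in> V"
      using t(1) by (metis imageE permutes_image)
    then have "v < t" "v \<in> R"
      using that t(2)[of v] by (auto simp: exc_perms_def)
    moreover have "w t \<in> V"
      using w t(1) by (simp add: permutes_in_image)
    then have "t \<in> C"
      using that t by (force simp: exc_perms_def)
    ultimately show ?thesis
      using v by blast
  qed
  show ?case
  proof (cases "N = {}")
    case True
    then have "D_perms V E = {}"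
      using graph by (subst D_perms.simps) (simp add: N_def t_def)
    \<comment> \<open>If its preimage were below \<open>m\<close>, it would be a neighbour of
      \<open>t\<close>.\<close>
    moreover have "\<not> (\<forall>v\<in>V. w v = t \<longrightarrow> v < m)" if "w \<in> exc_perms V R C" for w
      using preimage[OF that] True N by blast
    ultimately show ?thesis
      by (auto simp: t_def)
  next
    case False
    have "finite N"
      using N fin prems by (auto intro: finite_subset)
    then have "s \<in> N" "\<And>u. u \<in> N \<Longrightarrow> u \<le> s"
      using False by (auto simp: s_def)
    then have s: "s \<in> R" "s < t" "s < m" "t \<in> C" "s \<in> V"
      and max: "\<And>u. u \<in> R \<Longrightarrow> u < t \<Longrightarrow> u < m \<Longrightarrow> u \<le> s"
      using N prems by auto
    \<comment> \<open>The preimage of \<open>t\<close> is unique and lies in \<open>R\<close> below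
      \<open>t\<close>. If it is below \<open>m\<close>, it is at most \<open>s\<close>; conversely
      \<open>s < m\<close>.\<close>
    have bound: "(\<forall>v\<in>V. w v = t \<longrightarrow> v < m) \<longleftrightarrow> (\<forall>v\<in>V. w v = t \<longrightarrow> v < s) \<or> w s = t"
      if w: "w \<in> exc_perms V R C" for w
    proof -
      obtain v where v: "v \<in> V" "w v = t" "v < t" "v \<in> R"
        using preimage[OF w] by blast
      moreover have "u = v" if "w u = t" for u
        using w that v permutes_inj[of w V] by (auto simp: exc_perms_def dest: injD)
      ultimately show ?thesis
        using max[of v] s by (metis order.strict_trans order_le_less)
    qed
    show ?thesis
    proof (cases "V = {s, t}")
      case True
      then have "D_perms V E = {Transposition.transpose s t}"
        using graph False by (subst D_perms.simps) (simp add: N_def t_def s_def Let_def)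
      moreover have "exc_perms V R C = {Transposition.transpose s t}"
        using exc_perms_doubleton True s by blast
      ultimately show ?thesis
        using bound[of "Transposition.transpose s t"] by (auto simp: t_def)
    next
      case V: False
      note IH = "1.IH"[OF graph t_def False[unfolded N_def] s_def[unfolded N_def] V]
      have contr: "contract_vertices V s t = V - {t}"
        using s t by (auto simp: contract_vertices_def)
      \<comment> \<open>The maximum is not fixed, so its preimage is automatically smaller. The
        induction hypotheses for contraction and extraction are thus used with the new maximum as
        bound.\<close>
      have unbounded: "{w \<in> exc_perms V' R' C'. \<forall>v\<in>V'. w v = Max V' \<longrightarrow> v < Max V'} =
          exc_perms V' R' C'" if "finite V'" for V' R' C' :: "'a set"
        using that exc_perms_not_fixed[of _ V' R' C'] by (force simp: order.strict_iff_order)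
      have del: "D_perms V (delete_edges E s t) =
          {w \<in> exc_perms V R C. \<forall>v\<in>V. w v = t \<longrightarrow> v < s}"
        unfolding t_def
        using prems delete_exc_edges[OF le s(1-4) max] E
        by (intro IH(1)[unfolded t_def]) (auto simp: t_def)
      have con: "D_perms (contract_vertices V s t) (contract_edges E s t) =
          exc_perms (V - {t}) (R - {t}) (insert s C - {t})"
      proof -
        have *: "V - {t} \<noteq> {}" "finite (V - {t})"
            "R - {t} \<subseteq> V - {t}" "insert s C - {t} \<subseteq> V - {t}"
          using prems s by auto
        show ?thesis
          unfolding contr
          by (subst unbounded[OF *(2), symmetric],
              rule IH(2)[unfolded contr, OF *(2,1,3,4)])
            (unfold E, rule contract_exc_edges, use le s max in auto)
      qed
      have ext: "D_perms (extract_vertices V s t) (extract_edges E s t) =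
          exc_perms (V - {s, t}) (R - {s, t}) (C - {s, t})"
      proof -
        \<comment> \<open>Nonemptiness is where the exclusion of the base case
          \<open>V = {s, t}\<close> enters.\<close>
        have *: "V - {s, t} \<noteq> {}" "finite (V - {s, t})"
            "R - {s, t} \<subseteq> V - {s, t}" "C - {s, t} \<subseteq> V - {s, t}"
          using prems s t V by auto
        show ?thesis
          unfolding extract_vertices_def
          by (subst unbounded[OF *(2), symmetric],
              rule IH(3)[unfolded extract_vertices_def, OF *(2,1,3,4)])
            (simp add: E extract_exc_edges)
      qed
      have step: "D_perms V E = D_perms V (delete_edges E s t)
           \<union> {insert_after w s t |w. w \<in> D_perms (contract_vertices V s t) (contract_edges E s t)}
           \<union> {add_transposition w s t |w.
                w \<in> D_perms (extract_vertices V s t) (extract_edges E s t)}"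
        by (subst D_perms.simps, subst if_not_P[OF graph], unfold Let_def, fold t_def,
            fold N_def, fold s_def, subst if_not_P[OF False], subst if_not_P[OF V]) (rule refl)
      have "D_perms V E =
          {w \<in> exc_perms V R C. \<forall>v\<in>V. w v = t \<longrightarrow> v < s} \<union> {w \<in> exc_perms V R C. w s = t}"
        using exc_perms_maps_to_max[OF t(2) s(1,2,4,5) t(1)]
        unfolding step del con ext by (simp only: Un_assoc)
      also have "\<dots> = {w \<in> exc_perms V R C. \<forall>v\<in>V. w v = t \<longrightarrow> v < m}"
        using bound by blast
      finally show ?thesis
        by (simp add: t_def)
    qed
  qed
qed

section \<open>Specialization to the staircase\<close>

theorem corollary6p7:
  fixes r :: nat
  assumes "r \<ge> 1"
  shows "D_perms (staircase_vertices r) (staircase_edges r) = AE (2 * r)"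
proof -
  let ?V = "{1..2 * r}"
  let ?R = "{i \<in> ?V. odd i}" and ?C = "{i \<in> ?V. even i}"
  \<comment> \<open>Rows are the odd labels and columns the even ones. Bounding by the top vertex
    itself leaves all edges in place.\<close>
  have "staircase_edges r = exc_edges ?R ?C (Max ?V) (Max ?V)"
  proof (intro equalityI subsetI)
    fix d assume "d \<in> staircase_edges r"
    then obtain i j where "d = {2 * i + 1, 2 * j}" "i < j" "j \<le> r"
      by (auto simp: staircase_edges_eq)
    moreover from this have "2 * i + 1 \<in> ?R" "2 * j \<in> ?C" "2 * i + 1 < 2 * j"
      by auto
    ultimately show "d \<in> exc_edges ?R ?C (Max ?V) (Max ?V)"
      unfolding exc_edges_unbounded by blast
  next
    fix d assume "d \<in> exc_edges ?R ?C (Max ?V) (Max ?V)"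
    then obtain u v where "d = {u, v}" "u \<in> ?R" "v \<in> ?C" "u < v"
      unfolding exc_edges_unbounded by blast
    then have "odd u" "even v" "v \<le> 2 * r"
      by auto
    then obtain i j where "u = 2 * i + 1" "v = 2 * j"
      by (blast elim: oddE evenE)
    with \<open>d = {u, v}\<close> \<open>u < v\<close> \<open>v \<le> 2 * r\<close> have "d = {2 * i + 1, 2 * j}" "i < j" "j \<le> r"
      by auto
    then show "d \<in> staircase_edges r"
      unfolding staircase_edges_eq by blast
  qed
  then have "D_perms (staircase_vertices r) (staircase_edges r) =
      {w \<in> exc_perms ?V ?R ?C. \<forall>v\<in>?V. w v = Max ?V \<longrightarrow> v < Max ?V}"
    unfolding staircase_vertices_def using assms by (intro D_perms_exc_edges) auto
  also have "\<dots> = exc_perms ?V ?R ?C"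
    using exc_perms_not_fixed[of _ ?V ?R ?C] by (force simp: order.strict_iff_order)
  \<comment> \<open>Every label is odd or even, so its parity dictates the direction and rules out
    fixed points.\<close>
  also have "\<dots> = AE (2 * r)"
    by (auto simp: exc_perms_def AE_def)
  finally show ?thesis .
qed

end
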